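(* Let $0<\rho<1/2$, let $\eta_0$ be distributed according to the Bernoulli product measure $\mu^{(\rho)}$ of density $\rho$ on $\{0,1\}^{\mathbb Z}$, and let $\eta_\infty=\lim_{t\to\infty}\eta_t$ be the ($\mu^{(\rho)}$-a.s. existing) limit under the F-TASEP dynamics. Let $\mu$ be $\mu^{(\rho)}$ conditioned on $V=\{\eta_0: 0\in P(\eta_0)\}$, and let $g(k)=\mu^{(\rho)}(\eta_\infty(0)\eta_\infty(k))$ be the two-point function of the final state. Then: (a) For every $n\ge1$, $\mu(\eta_\infty(2n-1))=\rho$ (the expected value of $\eta_\infty(2n-1)$ under $\mu$ is $\rho$). (b) For every $n\ge1$, $g(2n-1)+g(2n)=2\rho^2$.
   Context: F-TASEP step $U$ on $\{0,1\}^{\mathbb Z}$ ($1$ = particle, $0$ = hole): simultaneously, every particle at a site $j$ with $\eta(j-1)=1$ and $\eta(j+1)=0$ moves to $j+1$; $\eta_t=U^t\eta_0$. For $\mu^{(\rho)}$-a.e. $\eta_0$ with $\rho<1/2$, each $\eta_t(i)$ is eventually constant in $t$, so $\eta_\infty$ is defined pointwise. For a configuration $\eta_0$, $h_0:\mathbb Z\to\mathbb Z$ is defined by $h_0(0)=0$, $h_0(k)-h_0(k-1)=(-1)^{\eta_0(k)}$, and $P(\eta_0)=\{p\in\mathbb Z: h_0(p)>\sup_{i<p}h_0(i)\}$. One has $\mu^{(\rho)}(V)>0$. For a measure $\lambda$ and a function $F$, $\lambda(F)$ is the expectation of $F$ under $\lambda$; $\eta_\infty$ is viewed as a function of $\eta_0$.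 *)

theory Defs
  imports "HOL-Probability.Probability"
begin

type_synonym config = "int \<Rightarrow> bool"

definition moves :: "config \<Rightarrow> int \<Rightarrow> bool" where
  "moves \<eta> j \<longleftrightarrow> \<eta> j \<and> \<eta> (j - 1) \<and> \<not> \<eta> (j + 1)"

text \<open>Synchronous update: a site is occupied afterwards iff its particle stays put or
  a particle jumps in from the left.\<close>

definition ftasep_step :: "config \<Rightarrow> config" where
  "ftasep_step \<eta> = (\<lambda>j. (\<eta> j \<and> \<not> moves \<eta> j) \<or> moves \<eta> (j - 1))"

definition evolve :: "nat \<Rightarrow> config \<Rightarrow> config" where
  "evolve t = ftasep_step ^^ t"

text \<open>The pointwise limit as a 0/1-valued real; the value is unspecified at sites where
  the occupation number does not converge.\<close>

definition final :: "config \<Rightarrow> int \<Rightarrow> real" where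
  "final \<eta> i = lim (\<lambda>t. of_bool (evolve t \<eta> i))"

definition bernoulli_measure :: "real \<Rightarrow> config measure" where
  "bernoulli_measure \<rho> = (\<Pi>\<^sub>M i\<in>UNIV. measure_pmf (bernoulli_pmf \<rho>))"

text \<open>At most one of the two sums is nonempty: the first one for positive and
  the second one for negative arguments.\<close>

definition height :: "config \<Rightarrow> int \<Rightarrow> int" where
  "height \<eta> k = (\<Sum>i\<in>{1..k}. (-1) ^ of_bool (\<eta> i)) - (\<Sum>i\<in>{k+1..0}. (-1) ^ of_bool (\<eta> i))"

lemma height_0 [simp]: "height \<eta> 0 = 0"
  by (simp add: height_def)

lemma height_diff: "height \<eta> k - height \<eta> (k - 1) = (-1) ^ of_bool (\<eta> k)"
proof (cases "k \<ge> 1")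
  case True
  then have "{1..k} = insert k {1..k - 1}" by auto
  with True show ?thesis by (simp add: height_def)
next
  case False
  then have "{k..0} = insert k {k + 1..0}" by auto
  with False show ?thesis by (simp add: height_def)
qed

text \<open>The supremum is taken in the extended reals because the heights to the left of
  a site may be unbounded above.\<close>

definition record_sites :: "config \<Rightarrow> int set" where
  "record_sites \<eta> = {p. ereal (real_of_int (height \<eta> p)) >
     (SUP i\<in>{..<p}. ereal (real_of_int (height \<eta> i)))}"

definition V :: "config set" where
  "V = {\<eta>. 0 \<in> record_sites \<eta>}"

text \<open>For an event of positive measure, \<^const>\<open>uniform_measure\<close> is the conditional measure
  given that event.\<close>

definition cond_measure :: "real \<Rightarrow> config measure" where
  "cond_measure \<rho> = uniform_measure (bernoulli_measure \<rho>) V"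

definition two_point :: "real \<Rightarrow> int \<Rightarrow> real" where
  "two_point \<rho> k = (\<integral>\<eta>. final \<eta> 0 * final \<eta> k \<partial>bernoulli_measure \<rho>)"

end

theory Submission
  imports Defs
begin

text \<open>
Lift the configuration to its height walk. A jump raises the height at a local minimum by \<open>2\<close>, back to
a level already attained to its left, so all running maxima are conserved while the heights
increase. The limit has no two adjacent particles, hence stays within \<open>1\<close> of its running maximum,
and as heights keep their parity, \<open>k\<close> is finally occupied iff the drop \<open>W\<^sub>k\<close> of the initial height
below its running maximum is odd. \<open>W\<close> is a walk on the natural numbers reflected at \<open>0\<close>, reversible
with respect to a geometric law. Its parity flips at every step except when it is held at \<open>0\<close>, and
started at \<open>0\<close> it is equally likely to be at \<open>0\<close> at the times \<open>2n - 1\<close> and \<open>2n\<close>; this gives (a),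
and (b) then follows by reversibility.
\<close>

section \<open>The limiting configuration\<close>

lemma height_pred: "height \<eta> (k - 1) = height \<eta> k - (if \<eta> k then -1 else 1)"
  using height_diff[of \<eta> k] by auto

lemma height_Suc: "height \<eta> (k + 1) = height \<eta> k + (if \<eta> (k + 1) then -1 else 1)"
  using height_diff[of \<eta> "k + 1"] by auto

text \<open>Recomputing \<open>height\<close> from \<open>evolve t \<eta>\<close> would reset the
  value at site 0 to 0 at every time. Carrying the jumps along gives an interface that only rises,
  by 2 at each jump.\<close>

primrec dyn_height :: "config \<Rightarrow> nat \<Rightarrow> int \<Rightarrow> int" where
  "dyn_height \<eta> 0 j = height \<eta> j"
| "dyn_height \<eta> (Suc t) j = dyn_height \<eta> t j + 2 * of_bool (moves (evolve t \<eta>) j)"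

text \<open>A jump from \<open>j\<close> exchanges the descent at \<open>j\<close> with the ascent
  at \<open>j + 1\<close>. Jumps from \<open>j - 1\<close> and \<open>j\<close> never coincide,
  since the former needs \<open>j\<close> empty.\<close>

lemma dyn_height_pred:
  "dyn_height \<eta> t (j - 1) = dyn_height \<eta> t j - (if evolve t \<eta> j then -1 else 1)"
proof (induction t arbitrary: j)
  case 0
  then show ?case by (simp add: evolve_def height_pred)
next
  case (Suc t)
  have "evolve (Suc t) \<eta> = ftasep_step (evolve t \<eta>)"
    by (simp add: evolve_def)
  with Suc.IH[of j] show ?case
    by (auto simp: ftasep_step_def moves_def)
qed

lemma dyn_height_incseq: "incseq (\<lambda>t. dyn_height \<eta> t j)"
  by (rule incseq_SucI) simp

lemma dyn_height_ge: "height \<eta> j \<le> dyn_height \<eta> t j"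
  using incseqD[OF dyn_height_incseq, of 0 t \<eta> j] by simp

lemma even_dyn_height_diff: "even (dyn_height \<eta> t j - height \<eta> j)"
  by (induction t) (auto simp: algebra_simps)

text \<open>A jump at \<open>j\<close> lifts the height at \<open>j\<close> only to that at \<open>j - 2\<close>, so running maxima do not grow.\<close>

lemma dyn_height_le:
  assumes "\<And>i. i \<le> k \<Longrightarrow> height \<eta> i \<le> B" and "j \<le> k"
  shows "dyn_height \<eta> t j \<le> B"
  using assms(2)
proof (induction t arbitrary: j)
  case 0
  then show ?case using assms(1) by simp
next
  case (Suc t)
  show ?case
  proof (cases "moves (evolve t \<eta>) j")
    case True
    then have "dyn_height \<eta> t (j - 1 - 1) = dyn_height \<eta> t j + 2"
      using dyn_height_pred[of \<eta> t j] dyn_height_pred[of \<eta> t "j - 1"] by (simp add: moves_def)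
    moreover have "dyn_height \<eta> t (j - 1 - 1) \<le> B"
      using Suc.prems by (intro Suc.IH) simp
    ultimately show ?thesis using True by simp
  next
    case False
    then show ?thesis using Suc by simp
  qed
qed

lemma incseq_int_eventually_const:
  fixes f :: "nat \<Rightarrow> int"
  assumes "incseq f" and "\<And>n. f n \<le> B"
  shows "\<exists>L. \<forall>\<^sub>F n in sequentially. f n = L"
proof -
  define g where "g n = nat (B - f n)" for n
  obtain N where N: "\<And>n. g N \<le> g n"
    using ex_has_least_nat[of "\<lambda>_. True" 0 g] by auto
  have "f n = f N" if "N \<le> n" for n
    using N[of n] incseqD[OF assms(1) that] assms(2)[of n] assms(2)[of N] by (simp add: g_def)
  then show ?thesis
    by (auto simp: eventually_sequentially)
qed

text \<open>Monotone integer heights below the running maximum stabilise. Boundedness to the left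
  gives this convergence; unboundedness rules out adjacent particles in the limit.\<close>

lemma limit_configuration:
  assumes bdd: "\<And>k. \<exists>B. \<forall>i\<le>k. height \<eta> i \<le> B"
    and unbdd: "\<And>B. \<exists>i. height \<eta> i > B"
  obtains H \<zeta> where "\<And>j. \<forall>\<^sub>F t in sequentially. evolve t \<eta> j = \<zeta> j"
    and "\<And>j. H (j - 1) = H j - (if \<zeta> j then -1 else (1::int))"
    and "\<And>j. height \<eta> j \<le> H j"
    and "\<And>j. even (H j - height \<eta> j)"
    and "\<And>j k B. (\<And>i. i \<le> k \<Longrightarrow> height \<eta> i \<le> B) \<Longrightarrow> j \<le> k \<Longrightarrow> H j \<le> B"
    and "\<And>j. \<not> (\<zeta> j \<and> \<zeta> (j + 1))"
proof -
  have "\<exists>L. \<forall>\<^sub>F t in sequentially. dyn_height \<eta> t j = L" for j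
  proof -
    obtain B where "\<forall>i\<le>j. height \<eta> i \<le> B" using bdd by blast
    then show ?thesis
      using dyn_height_le[of j \<eta> B j] by (intro incseq_int_eventually_const[OF dyn_height_incseq]) auto
  qed
  then obtain H where H: "\<And>j. \<forall>\<^sub>F t in sequentially. dyn_height \<eta> t j = H j"
    by metis
  define \<zeta> where "\<zeta> j = (H j - H (j - 1) = -1)" for j
  have both: "\<forall>\<^sub>F t in sequentially. dyn_height \<eta> t j = H j \<and> dyn_height \<eta> t (j - 1) = H (j - 1)" for j
    using H[of j] H[of "j - 1"] by eventually_elim simp
  have conf: "\<forall>\<^sub>F t in sequentially. evolve t \<eta> j = \<zeta> j" for j
    using both[of j]
  proof eventually_elim
    case (elim t)
    then show ?case using dyn_height_pred[of \<eta> t j] by (simp add: \<zeta>_def split: if_splits)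
  qed
  have step: "H (j - 1) = H j - (if \<zeta> j then -1 else 1)" for j
  proof -
    have "\<forall>\<^sub>F t in sequentially. H (j - 1) = H j - (if \<zeta> j then -1 else 1)"
      using both[of j] conf[of j]
    proof eventually_elim
      case (elim t)
      then show ?case using dyn_height_pred[of \<eta> t j] by simp
    qed
    then show ?thesis by simp
  qed
  have ge: "height \<eta> j \<le> H j" for j
  proof -
    have "\<forall>\<^sub>F t in sequentially. height \<eta> j \<le> H j"
      using H[of j] by eventually_elim (metis dyn_height_ge)
    then show ?thesis by simp
  qed
  have even: "even (H j - height \<eta> j)" for j
  proof -
    have "\<forall>\<^sub>F t in sequentially. even (H j - height \<eta> j)"
      using H[of j] by eventually_elim (metis even_dyn_height_diff)
    then show ?thesis by simp
  qed
  have le: "H j \<le> B" if "\<And>i. i \<le> k \<Longrightarrow> height \<eta> i \<le> B" "j \<le> k" for j k B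
  proof -
    have "\<forall>\<^sub>F t in sequentially. H j \<le> B"
      using H[of j] by eventually_elim (metis dyn_height_le that)
    then show ?thesis by simp
  qed
  \<comment> \<open>Otherwise the particle at \<open>j\<close> would jump at late times and raise a
    height that has already stabilised.\<close>
  have no110: "\<zeta> (j + 1)" if "\<zeta> (j - 1)" "\<zeta> j" for j
  proof (rule ccontr)
    assume hole: "\<not> \<zeta> (j + 1)"
    have "\<forall>\<^sub>F t in sequentially. dyn_height \<eta> (Suc t) j = H j"
      using H[of j] by (subst eventually_sequentially_Suc)
    with H[of j] conf[of j] conf[of "j - 1"] conf[of "j + 1"]
    have "\<forall>\<^sub>F t in sequentially. False"
    proof eventually_elim
      case (elim t)
      then have "moves (evolve t \<eta>) j" using that hole by (simp add: moves_def)
      with elim show ?case by simp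
    qed
    then show False by simp
  qed
  have no11: "\<not> (\<zeta> j \<and> \<zeta> (j + 1))" for j
  proof
    assume j: "\<zeta> j \<and> \<zeta> (j + 1)"
    \<comment> \<open>By \<open>no110\<close> a pair of adjacent particles propagates to the right,
      so \<open>H\<close> decreases forever from \<open>j\<close>.\<close>
    have full: "\<zeta> (j + int n) \<and> \<zeta> (j + int n + 1)" for n
    proof (induction n)
      case 0
      show ?case using j by simp
    next
      case (Suc n)
      then show ?case using no110[of "j + int n + 1"] by (simp add: algebra_simps)
    qed
    have desc: "H (j + int n) \<le> H j" for n
    proof (induction n)
      case (Suc n)
      have "H (j + int (Suc n) - 1) = H (j + int (Suc n)) + 1"
        using step[of "j + int (Suc n)"] full[of "Suc n"] by simp
      with Suc show ?case by simp
    qed simp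
    obtain B where B: "\<forall>i\<le>j. height \<eta> i \<le> B" using bdd by blast
    \<comment> \<open>Exceeding \<open>B\<close> puts \<open>i\<close> to the right of
      \<open>j\<close>; exceeding \<open>H j\<close> contradicts the descent of \<open>H\<close>
      there.\<close>
    obtain i where i: "height \<eta> i > max B (H j)" using unbdd by blast
    show False
    proof (cases "i \<le> j")
      case True
      with B i show False by force
    next
      case False
      then have "i = j + int (nat (i - j))" by simp
      then have "H i \<le> H j" using desc by metis
      with ge[of i] i show False by simp
    qed
  qed
  show thesis
    by (rule that[of \<zeta> H, OF conf step ge even le no11])
qed

text \<open>Between \<open>p\<close> and \<open>k\<close> the limiting height stays in
  \<open>{C - 1, C}\<close> and is \<open>C - 1\<close> exactly at particles. Since
  \<open>H k\<close> and \<open>height \<eta> k\<close> have equal parity, occupation can be read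
  off from the initial heights.\<close>

lemma final_eq_odd_height:
  assumes bdd: "\<And>k. \<exists>B. \<forall>i\<le>k. height \<eta> i \<le> B"
    and unbdd: "\<And>B. \<exists>i. height \<eta> i > B"
    and p: "p \<le> k" "\<And>i. i \<le> k \<Longrightarrow> height \<eta> i \<le> height \<eta> p"
  shows "final \<eta> k = of_bool (odd (height \<eta> p - height \<eta> k))"
proof (rule limit_configuration[OF bdd unbdd])
  fix H :: "int \<Rightarrow> int" and \<zeta>
  assume conf: "\<And>j. \<forall>\<^sub>F t in sequentially. evolve t \<eta> j = \<zeta> j"
    and step: "\<And>j. H (j - 1) = H j - (if \<zeta> j then -1 else 1)"
    and ge: "\<And>j. height \<eta> j \<le> H j"
    and even: "\<And>j. even (H j - height \<eta> j)"
    and le: "\<And>j k B. (\<And>i. i \<le> k \<Longrightarrow> height \<eta> i \<le> B) \<Longrightarrow> j \<le> k \<Longrightarrow> H j \<le> B"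
    and no11: "\<And>j. \<not> (\<zeta> j \<and> \<zeta> (j + 1))"
  define C where "C = height \<eta> p"
  have leC: "H i \<le> C" if "i \<le> k" for i
    using le[of k C i] p that by (simp add: C_def)
  have "H (p + int n) = (if \<zeta> (p + int n) then C - 1 else C)" if "p + int n \<le> k" for n
    using that
  proof (induction n)
    case 0
    have "H p = C"
      using leC[OF p(1)] ge[of p] by (simp add: C_def)
    moreover have "\<not> \<zeta> p"
      using leC[of "p - 1"] step[of p] \<open>H p = C\<close> p(1) by auto
    ultimately show ?case by simp
  next
    \<comment> \<open>From \<open>C\<close> a hole would exceed the maximum; from
      \<open>C - 1\<close> a second particle would be adjacent to the first.\<close>
    case (Suc n)
    then show ?case
      using step[of "p + int n + 1"] no11[of "p + int n"] leC[of "p + int n + 1"]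
      by (auto simp: algebra_simps split: if_splits)
  qed
  from this[of "nat (k - p)"] have "H k = (if \<zeta> k then C - 1 else C)"
    using p(1) by simp
  with even[of k] have odd: "\<zeta> k \<longleftrightarrow> odd (C - height \<eta> k)"
    by (auto split: if_splits)
  have "(\<lambda>t. of_bool (evolve t \<eta> k)) \<longlonglongrightarrow> (of_bool (\<zeta> k) :: real)"
    using conf[of k] by (intro tendsto_eventually) (auto elim: eventually_mono)
  then have "final \<eta> k = of_bool (\<zeta> k)"
    unfolding final_def by (rule limI)
  with odd show ?thesis by (simp add: C_def)
qed

section \<open>The reflected walk\<close>

text \<open>Truncated subtraction on \<open>nat\<close> is the reflection: a hole met at 0 leaves
  the walk at 0.\<close>

definition queue_step :: "bool \<Rightarrow> nat \<Rightarrow> nat" where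
  "queue_step b w = (if b then w + 1 else w - 1)"

text \<open>The height walk below its running maximum, started from \<open>0\<close> at the site \<open>s - m\<close> and
  observed at \<open>s\<close>.\<close>

primrec queue :: "config \<Rightarrow> int \<Rightarrow> nat \<Rightarrow> nat" where
  "queue \<eta> s 0 = 0"
| "queue \<eta> s (Suc m) = queue_step (\<eta> s) (queue \<eta> (s - 1) m)"

declare queue.simps(2)[simp del]

text \<open>The walk started earlier is at least 0 where the later one starts at 0, and
  \<open>queue_step\<close> is monotone.\<close>

lemma queue_incseq: "incseq (queue \<eta> s)"
proof (rule incseq_SucI)
  fix m
  show "queue \<eta> s m \<le> queue \<eta> s (Suc m)"
  proof (induction m arbitrary: s)
    case (Suc m)
    from Suc[of "s - 1"] show ?case
      unfolding queue.simps(2)[of \<eta> s "Suc m"] queue.simps(2)[of \<eta> s m]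
      by (simp add: queue_step_def diff_le_mono)
  qed simp
qed

text \<open>Dependence on sites up to \<open>s\<close> only is what lets later sites be resampled in
  the Markov property.\<close>

lemma queue_fun_upd: "s < i \<Longrightarrow> queue (\<eta>(i := b)) s m = queue \<eta> s m"
  by (induction m arbitrary: s) (auto simp: queue.simps(2))

text \<open>The walk is the maximum of the height over the window minus its value at
  \<open>s\<close> (Lindley's formula). Comparing with an arbitrary integer \<open>c\<close>
  replaces the maximum by a condition that merely shifts \<open>c\<close> in the induction.\<close>

lemma queue_le_iff:
  "int (queue \<eta> s m) \<le> c \<longleftrightarrow> (\<forall>i\<in>{s - int m..s}. height \<eta> i - height \<eta> s \<le> c)"
proof (induction m arbitrary: s c)
  case 0
  then show ?case by auto
next
  case (Suc m)
  have ivl: "{s - int (Suc m)..s} = insert s {s - 1 - int m..s - 1}" by auto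
  have mem: "s - 1 \<in> {s - 1 - int m..s - 1}" by simp
  show ?case
  proof (cases "\<eta> s")
    case True
    then have *: "height \<eta> (s - 1) = height \<eta> s + 1" by (simp add: height_pred)
    have "int (queue \<eta> s (Suc m)) \<le> c \<longleftrightarrow> int (queue \<eta> (s - 1) m) \<le> c - 1"
      using True by (auto simp: queue.simps(2) queue_step_def)
    also have "\<dots> \<longleftrightarrow> (\<forall>i\<in>{s - 1 - int m..s - 1}. height \<eta> i - height \<eta> s \<le> c)"
      unfolding Suc * by (simp add: algebra_simps)
    also have "\<dots> \<longleftrightarrow> (\<forall>i\<in>{s - int (Suc m)..s}. height \<eta> i - height \<eta> s \<le> c)"
      unfolding ivl using bspec[OF _ mem, of "\<lambda>i. height \<eta> i - height \<eta> s \<le> c"] * by fastforce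
    finally show ?thesis .
  next
    case False
    then have *: "height \<eta> (s - 1) = height \<eta> s - 1" by (simp add: height_pred)
    have "int (queue \<eta> s (Suc m)) \<le> c \<longleftrightarrow> 0 \<le> c \<and> int (queue \<eta> (s - 1) m) \<le> c + 1"
      using False by (auto simp: queue.simps(2) queue_step_def)
    also have "\<dots> \<longleftrightarrow> 0 \<le> c \<and> (\<forall>i\<in>{s - 1 - int m..s - 1}. height \<eta> i - height \<eta> s \<le> c)"
      unfolding Suc * by (simp add: algebra_simps)
    also have "\<dots> \<longleftrightarrow> (\<forall>i\<in>{s - int (Suc m)..s}. height \<eta> i - height \<eta> s \<le> c)"
      unfolding ivl by auto
    finally show ?thesis .
  qed
qed

lemma queue_eq_height_diff:
  obtains i where "i \<in> {s - int m..s}" and "int (queue \<eta> s m) = height \<eta> i - height \<eta> s"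
proof -
  \<comment> \<open>The bound fails one below the value of the walk, and the witness of the failure
    is a maximiser.\<close>
  have "\<not> int (queue \<eta> s m) \<le> int (queue \<eta> s m) - 1" by simp
  then obtain i where i: "i \<in> {s - int m..s}" "height \<eta> i - height \<eta> s > int (queue \<eta> s m) - 1"
    unfolding queue_le_iff by fastforce
  moreover have "height \<eta> i - height \<eta> s \<le> int (queue \<eta> s m)"
    using queue_le_iff[of \<eta> s m "int (queue \<eta> s m)"] i(1) by blast
  ultimately show thesis using that by simp
qed

lemma queue_bounded_iff:
  "(\<forall>m. int (queue \<eta> s m) \<le> c) \<longleftrightarrow> (\<forall>i\<le>s. height \<eta> i - height \<eta> s \<le> c)"
proof (intro iffI allI impI)
  fix i assume "\<forall>m. int (queue \<eta> s m) \<le> c" "i \<le> s"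
  then show "height \<eta> i - height \<eta> s \<le> c"
    using queue_le_iff[of \<eta> s "nat (s - i)" c] by simp
qed (simp add: queue_le_iff)

text \<open>Bounded and monotone in \<open>m\<close>, the walk stabilises, and its limit is the drop
  at \<open>k\<close> below the running maximum.\<close>

lemma final_eq_odd_queue:
  assumes bdd: "\<And>s. \<exists>B. \<forall>m. queue \<eta> s m \<le> B"
    and unbdd: "\<And>B. \<exists>i. height \<eta> i > B"
  shows "\<forall>\<^sub>F m in sequentially. final \<eta> k = of_bool (odd (queue \<eta> k m))"
proof -
  have bdd': "\<exists>B. \<forall>i\<le>k. height \<eta> i \<le> B" for k
  proof -
    obtain B where "\<forall>m. queue \<eta> k m \<le> B" using bdd by blast
    then have "\<forall>i\<le>k. height \<eta> i - height \<eta> k \<le> int B"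
      by (simp flip: queue_bounded_iff)
    then have "\<forall>i\<le>k. height \<eta> i \<le> int B + height \<eta> k"
      by (simp add: algebra_simps)
    then show ?thesis by blast
  qed
  obtain B where B: "\<And>m. queue \<eta> k m \<le> B" using bdd by blast
  have "incseq (\<lambda>m. int (queue \<eta> k m))"
    using queue_incseq[of \<eta> k] by (simp add: incseq_def)
  then obtain L where L: "\<forall>\<^sub>F m in sequentially. int (queue \<eta> k m) = L"
    using incseq_int_eventually_const[of "\<lambda>m. int (queue \<eta> k m)" "int B"] B by auto
  then obtain N where N: "\<And>m. N \<le> m \<Longrightarrow> int (queue \<eta> k m) = L"
    by (auto simp: eventually_sequentially)
  \<comment> \<open>A window long enough to stabilise the walk contains a maximiser over the whole
    left half-line.\<close>
  obtain p where p: "p \<in> {k - int N..k}" "int (queue \<eta> k N) = height \<eta> p - height \<eta> k"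
    by (rule queue_eq_height_diff)
  have "int (queue \<eta> k m) \<le> L" for m
    using N[of "max m N"] incseqD[OF queue_incseq, of m "max m N" \<eta> k] by simp
  then have "\<forall>i\<le>k. height \<eta> i - height \<eta> k \<le> L"
    by (simp flip: queue_bounded_iff)
  with p N[of N] have "final \<eta> k = of_bool (odd (height \<eta> p - height \<eta> k))"
    by (intro final_eq_odd_height bdd' unbdd) auto
  then have "final \<eta> k = of_bool (odd L)"
    using p N[of N] by simp
  with L show ?thesis
    by (auto elim: eventually_mono)
qed

text \<open>By integrality a record at 0 bounds all heights to the left by -1. Height -1 at site -1
  means a hole at 0, and no earlier height exceeds it exactly when the walk is at 0 there for every
  start.\<close>

lemma V_eq: "V = {\<eta>. \<not> \<eta> 0 \<and> (\<forall>m. queue \<eta> (-1) m = 0)}"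
proof -
  have sup: "(SUP i\<in>{..<0}. ereal (real_of_int (height \<eta> i))) < 0 \<longleftrightarrow> (\<forall>i\<le>-1. height \<eta> i \<le> -1)" for \<eta>
  proof
    assume *: "(SUP i\<in>{..<0}. ereal (real_of_int (height \<eta> i))) < 0"
    show "\<forall>i\<le>-1. height \<eta> i \<le> -1"
    proof (intro allI impI)
      fix i :: int assume "i \<le> -1"
      then have "ereal (real_of_int (height \<eta> i)) \<le> (SUP i\<in>{..<0}. ereal (real_of_int (height \<eta> i)))"
        by (intro SUP_upper) simp
      also note *
      finally show "height \<eta> i \<le> -1" by simp
    qed
  next
    assume "\<forall>i\<le>-1. height \<eta> i \<le> -1"
    then have "(SUP i\<in>{..<0}. ereal (real_of_int (height \<eta> i))) \<le> ereal (-1)"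
      by (intro SUP_least) (force simp flip: of_int_le_iff[where 'a = real])
    also have "\<dots> < 0" by simp
    finally show "(SUP i\<in>{..<0}. ereal (real_of_int (height \<eta> i))) < 0" .
  qed
  have "\<eta> \<in> V \<longleftrightarrow> \<not> \<eta> 0 \<and> (\<forall>m. queue \<eta> (-1) m = 0)" for \<eta>
  proof -
    have h: "height \<eta> (-1) = (if \<eta> 0 then 1 else -1)"
      using height_pred[of \<eta> 0] by simp
    have "\<eta> \<in> V \<longleftrightarrow> (\<forall>i\<le>-1. height \<eta> i \<le> -1)"
      by (simp add: V_def record_sites_def sup flip: zero_ereal_def)
    also have "\<dots> \<longleftrightarrow> \<not> \<eta> 0 \<and> (\<forall>i\<le>-1. height \<eta> i - height \<eta> (-1) \<le> 0)"
    proof (cases "\<eta> 0")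
      case True
      with h have "\<not> (\<forall>i\<le>-1. height \<eta> i \<le> -1)" by (intro notI) (drule spec[of _ "-1"], simp)
      with True show ?thesis by simp
    next
      case False
      have "a + 1 \<le> 0 \<longleftrightarrow> a \<le> -1" for a :: int by auto
      with h False show ?thesis by simp
    qed
    also have "\<dots> \<longleftrightarrow> \<not> \<eta> 0 \<and> (\<forall>m. queue \<eta> (-1) m = 0)"
      using queue_bounded_iff[of \<eta> "-1" 0] by simp
    finally show ?thesis .
  qed
  then show ?thesis by (intro set_eqI) simp
qed

text \<open>The value at \<open>s\<close> does not depend on the start, so everything before
  \<open>s\<close> is forgotten.\<close>

lemma queue_from_zero:
  assumes "\<And>m. queue \<eta> s m = 0"
  shows "queue \<eta> (s + int k) (m + k) = queue \<eta> (s + int k) k"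
proof (induction k)
  case (Suc k)
  moreover have "s + int (Suc k) - 1 = s + int k" by simp
  ultimately show ?case by (simp only: add_Suc_right queue.simps(2))
qed (simp add: assms)

section \<open>The Bernoulli measure\<close>

lemma space_bernoulli_measure [simp]: "space (bernoulli_measure \<rho>) = UNIV"
  by (simp add: bernoulli_measure_def space_PiM PiE_UNIV_domain)

lemma measurable_site [measurable]:
  "(\<lambda>\<eta>. \<eta> i) \<in> bernoulli_measure \<rho> \<rightarrow>\<^sub>M count_space UNIV"
proof -
  have "(\<lambda>\<eta>. \<eta> i) \<in> bernoulli_measure \<rho> \<rightarrow>\<^sub>M measure_pmf (bernoulli_pmf \<rho>)"
    unfolding bernoulli_measure_def by (rule measurable_component_singleton) simp
  then show ?thesis by simp
qed

lemma measurable_queue [measurable]: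
  "(\<lambda>\<eta>. queue \<eta> s m) \<in> bernoulli_measure \<rho> \<rightarrow>\<^sub>M count_space UNIV"
proof (induction m arbitrary: s)
  case (Suc m)
  have [measurable]: "(\<lambda>\<eta>. queue \<eta> (s - 1) m) \<in> bernoulli_measure \<rho> \<rightarrow>\<^sub>M count_space UNIV"
    by (rule Suc)
  show ?case unfolding queue.simps(2) queue_step_def by measurable
qed simp

lemma measurable_evolve [measurable]:
  "(\<lambda>\<eta>. evolve t \<eta> i) \<in> bernoulli_measure \<rho> \<rightarrow>\<^sub>M count_space UNIV"
proof (induction t arbitrary: i)
  case 0
  show ?case by (simp add: evolve_def)
next
  case (Suc t)
  note Suc[measurable]
  have "evolve (Suc t) \<eta> = ftasep_step (evolve t \<eta>)" for \<eta>
    by (simp add: evolve_def)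
  then show ?case
    unfolding ftasep_step_def moves_def by simp measurable
qed

lemma measurable_final [measurable]: "(\<lambda>\<eta>. final \<eta> i) \<in> borel_measurable (bernoulli_measure \<rho>)"
  unfolding final_def by measurable

lemma measurable_height [measurable]:
  "(\<lambda>\<eta>. height \<eta> k) \<in> bernoulli_measure \<rho> \<rightarrow>\<^sub>M count_space UNIV"
proof -
  have nat: "(\<lambda>\<eta>. height \<eta> (int n)) \<in> bernoulli_measure \<rho> \<rightarrow>\<^sub>M count_space UNIV" for n
  proof (induction n)
    case (Suc n)
    note Suc[measurable]
    have "height \<eta> (int (Suc n)) = height \<eta> (int n) + (if \<eta> (int n + 1) then -1 else 1)" for \<eta>
      using height_Suc[of \<eta> "int n"] by (simp add: add.commute)
    then show ?case by simp
  qed simp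
  have neg: "(\<lambda>\<eta>. height \<eta> (- int n)) \<in> bernoulli_measure \<rho> \<rightarrow>\<^sub>M count_space UNIV" for n
  proof (induction n)
    case (Suc n)
    note Suc[measurable]
    have "height \<eta> (- int (Suc n)) = height \<eta> (- int n) - (if \<eta> (- int n) then -1 else 1)" for \<eta>
    proof -
      have "- int (Suc n) = - int n - 1" by simp
      then show ?thesis by (simp only: height_pred)
    qed
    then show ?case by simp
  qed simp
  show ?thesis
    by (cases k rule: int_cases2) (use nat neg in auto)
qed

lemma sets_V [measurable]: "V \<in> sets (bernoulli_measure \<rho>)"
proof -
  have "{\<eta> \<in> space (bernoulli_measure \<rho>). \<not> \<eta> 0 \<and> (\<forall>m. queue \<eta> (-1) m = 0)} \<in> sets (bernoulli_measure \<rho>)"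
    by measurable
  then show ?thesis by (simp add: V_eq)
qed

section \<open>The transition operator of the reflected walk\<close>

text \<open>The one-step transition operator: \<open>(queue_op \<rho> ^^ t) f w\<close> is the
  expectation of \<open>f\<close> after \<open>t\<close> steps from \<open>w\<close>. Truncation in
  \<open>w - 1\<close> holds the walk at 0.\<close>

definition queue_op :: "real \<Rightarrow> (nat \<Rightarrow> real) \<Rightarrow> nat \<Rightarrow> real" where
  "queue_op \<rho> f w = \<rho> * f (w + 1) + (1 - \<rho>) * f (w - 1)"

abbreviation odd_ind :: "nat \<Rightarrow> real" where
  "odd_ind w \<equiv> of_bool (odd w)"

abbreviation at_least :: "nat \<Rightarrow> nat \<Rightarrow> real" where
  "at_least v w \<equiv> of_bool (v \<le> w)"

lemma queue_op_lincomb: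
  "queue_op \<rho> (\<lambda>w. a * f w + b * g w) = (\<lambda>w. a * queue_op \<rho> f w + b * queue_op \<rho> g w)"
  by (simp add: queue_op_def fun_eq_iff algebra_simps)

lemma queue_op_pow_lincomb:
  "(queue_op \<rho> ^^ t) (\<lambda>w. a * f w + b * g w) =
   (\<lambda>w. a * (queue_op \<rho> ^^ t) f w + b * (queue_op \<rho> ^^ t) g w)"
  by (induction t) (simp_all add: queue_op_lincomb)

lemma queue_op_pow_const [simp]: "(queue_op \<rho> ^^ t) (\<lambda>_. c) = (\<lambda>_. c)"
  by (induction t) (simp_all add: queue_op_def fun_eq_iff algebra_simps)

text \<open>Parity flips unless the walk is held at 0 by a hole, which has probability
  \<open>1 - \<rho>\<close>. The shape of the right-hand side is that of
  \<open>queue_op_pow_lincomb\<close>.\<close>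

lemma queue_op_odd:
  "queue_op \<rho> odd_ind = (\<lambda>w. 1 * (1 - odd_ind w) + - (1 - \<rho>) * of_bool (w = 0))"
proof
  fix w
  show "queue_op \<rho> odd_ind w = 1 * (1 - odd_ind w) + - (1 - \<rho>) * of_bool (w = 0)"
    by (cases w) (auto simp: queue_op_def)
qed

text \<open>Siegmund duality: the threshold performs a dual walk, down with probability \<rho> and
  up otherwise. Threshold 0 is absorbing, as \<open>at_least 0\<close> is constant.\<close>

lemma queue_op_at_least:
  "v \<ge> 1 \<Longrightarrow> queue_op \<rho> (at_least v) = (\<lambda>w. \<rho> * at_least (v - 1) w + (1 - \<rho>) * at_least (v + 1) w)"
  by (auto simp: queue_op_def fun_eq_iff)

lemma queue_op_pow_at_least:
  assumes "v \<ge> 1"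
  shows "(queue_op \<rho> ^^ Suc t) (at_least v) w =
    \<rho> * (queue_op \<rho> ^^ t) (at_least (v - 1)) w + (1 - \<rho>) * (queue_op \<rho> ^^ t) (at_least (v + 1)) w"
  unfolding funpow_Suc_right comp_def queue_op_at_least[OF assms] queue_op_pow_lincomb by simp

text \<open>For the start at 0 this is the probability that the dual walk from \<open>v\<close> is
  absorbed at 0 by time \<open>t\<close>. Absorption happens only at times of the parity of
  \<open>v\<close>, so time \<open>t + 1\<close> adds nothing.\<close>

lemma queue_op_pow_at_least_parity:
  assumes "v \<ge> 1" and "even (t + v)"
  shows "(queue_op \<rho> ^^ Suc t) (at_least v) 0 = (queue_op \<rho> ^^ t) (at_least v) 0"
  using assms
proof (induction t arbitrary: v)
  case 0
  then show ?case by (auto simp: queue_op_def elim!: evenE)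
next
  case (Suc t)
  have "(queue_op \<rho> ^^ Suc t) (at_least (v + 1)) 0 = (queue_op \<rho> ^^ t) (at_least (v + 1)) 0"
    using Suc.prems by (intro Suc.IH) auto
  \<comment> \<open>Threshold 0 is outside the induction hypothesis, but its indicator is
    constant.\<close>
  moreover have "(queue_op \<rho> ^^ Suc t) (at_least (v - 1)) 0 = (queue_op \<rho> ^^ t) (at_least (v - 1)) 0"
  proof (cases "v = 1")
    case True
    then show ?thesis by (simp del: funpow.simps)
  next
    case False
    then show ?thesis using Suc.prems by (intro Suc.IH) auto
  qed
  ultimately show ?case
    unfolding queue_op_pow_at_least[OF Suc.prems(1), where t = "Suc t"]
      queue_op_pow_at_least[OF Suc.prems(1), where t = t] by (simp only:)
qed

lemma queue_op_pow_Suc_odd: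
  "(queue_op \<rho> ^^ Suc t) odd_ind w =
    1 - (queue_op \<rho> ^^ t) odd_ind w - (1 - \<rho>) * (queue_op \<rho> ^^ t) (\<lambda>w. of_bool (w = 0)) w"
proof -
  have "(queue_op \<rho> ^^ t) (\<lambda>w. 1 - odd_ind w) w = 1 - (queue_op \<rho> ^^ t) odd_ind w"
    using queue_op_pow_lincomb[of t \<rho> 1 "\<lambda>_. 1" "-1" odd_ind] by simp
  then show ?thesis
    unfolding funpow_Suc_right comp_def queue_op_odd queue_op_pow_lincomb by (simp add: algebra_simps)
qed

lemma queue_op_pow_zero:
  "(queue_op \<rho> ^^ t) (\<lambda>w. of_bool (w = 0)) w = 1 - (queue_op \<rho> ^^ t) (at_least 1) w"
proof -
  have "(\<lambda>w::nat. of_bool (w = 0)) = (\<lambda>w. 1 * 1 + -1 * at_least 1 w)"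
    by (auto simp: fun_eq_iff)
  then show ?thesis by (simp only: queue_op_pow_lincomb queue_op_pow_const)
qed

text \<open>Over two steps the parity flips cancel, and so do the holding corrections, because the
  probabilities of being at 0 at times \<open>2 * n + 1\<close> and \<open>2 * n + 2\<close>
  agree.\<close>

lemma queue_op_pow_odd_at_0:
  "(queue_op \<rho> ^^ (2 * n + 1)) odd_ind 0 = \<rho>"
proof (induction n)
  case 0
  show ?case by (simp add: queue_op_def)
next
  case (Suc n)
  have "(queue_op \<rho> ^^ (2 * n + 2)) (at_least 1) 0 = (queue_op \<rho> ^^ (2 * n + 1)) (at_least 1) 0"
    using queue_op_pow_at_least_parity[of 1 "2 * n + 1"] by simp
  moreover have "(queue_op \<rho> ^^ (2 * n + 3)) odd_ind 0 = 1 - (queue_op \<rho> ^^ (2 * n + 2)) odd_ind 0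
     - (1 - \<rho>) * (1 - (queue_op \<rho> ^^ (2 * n + 2)) (at_least 1) 0)"
    using queue_op_pow_Suc_odd[of "2 * n + 2" \<rho> 0] unfolding queue_op_pow_zero by (simp add: numeral_3_eq_3)
  moreover have "(queue_op \<rho> ^^ (2 * n + 2)) odd_ind 0 = 1 - (queue_op \<rho> ^^ (2 * n + 1)) odd_ind 0
     - (1 - \<rho>) * (1 - (queue_op \<rho> ^^ (2 * n + 1)) (at_least 1) 0)"
    using queue_op_pow_Suc_odd[of "2 * n + 1" \<rho> 0] unfolding queue_op_pow_zero by simp
  moreover have "2 * Suc n + 1 = 2 * n + 3" by simp
  ultimately show ?case using Suc by (simp only:)
qed

lemma queue_op_abs_le:
  assumes "0 \<le> \<rho>" "\<rho> \<le> 1" and "\<And>w. \<bar>f w\<bar> \<le> 1"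
  shows "\<bar>queue_op \<rho> f w\<bar> \<le> 1"
proof -
  have "\<bar>queue_op \<rho> f w\<bar> \<le> \<rho> * \<bar>f (w + 1)\<bar> + (1 - \<rho>) * \<bar>f (w - 1)\<bar>"
    unfolding queue_op_def using assms(1,2) by (intro order.trans[OF abs_triangle_ineq]) (simp add: abs_mult)
  also have "\<dots> \<le> \<rho> * 1 + (1 - \<rho>) * 1"
    using assms by (intro add_mono mult_left_mono) auto
  finally show ?thesis by simp
qed

lemma queue_op_pow_abs_le:
  assumes "0 \<le> \<rho>" "\<rho> \<le> 1" and "\<And>w. \<bar>f w\<bar> \<le> 1"
  shows "\<bar>(queue_op \<rho> ^^ t) f w\<bar> \<le> 1"
  by (induction t arbitrary: w) (use assms queue_op_abs_le in auto)

text \<open>The factor next to \<open>f v\<close> is the \<open>t\<close>-step transition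
  probability from \<open>u\<close> to \<open>v\<close>; the expansion carries convergence over from
  point probabilities to functions.\<close>

lemma queue_op_pow_sums:
  "(\<lambda>v. f v * (queue_op \<rho> ^^ t) (\<lambda>w. of_bool (w = v)) u) sums (queue_op \<rho> ^^ t) f u"
proof (induction t arbitrary: u)
  case 0
  have "(\<lambda>v. if v = u then f u else 0) sums f u"
    by (rule sums_If_finite_set[of "{u}", simplified])
  moreover have "(\<lambda>v. f v * of_bool (u = v)) = (\<lambda>v. if v = u then f u else 0)"
    by auto
  ultimately show ?case by simp
next
  case (Suc t)
  have "(\<lambda>v. \<rho> * (f v * (queue_op \<rho> ^^ t) (\<lambda>w. of_bool (w = v)) (u + 1)) +
      (1 - \<rho>) * (f v * (queue_op \<rho> ^^ t) (\<lambda>w. of_bool (w = v)) (u - 1)))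
    sums (\<rho> * (queue_op \<rho> ^^ t) f (u + 1) + (1 - \<rho>) * (queue_op \<rho> ^^ t) f (u - 1))"
    by (intro sums_add sums_mult Suc)
  moreover have "(queue_op \<rho> ^^ Suc t) g u =
      \<rho> * (queue_op \<rho> ^^ t) g (u + 1) + (1 - \<rho>) * (queue_op \<rho> ^^ t) g (u - 1)" for g
    by (simp add: queue_op_def)
  ultimately show ?case
    by (simp only: ring_distribs mult.left_commute)
qed

lemma abs_mult_le_1: "\<bar>a\<bar> \<le> 1 \<Longrightarrow> \<bar>b\<bar> \<le> 1 \<Longrightarrow> \<bar>a * b :: real\<bar> \<le> 1"
  by (simp add: abs_mult mult_le_one)

section \<open>Geometric tails and exponential convergence of the reflected walk\<close>

context
  fixes \<rho> :: real
  assumes rho: "0 < \<rho>" "\<rho> < 1 / 2"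
begin

definition ratio :: real where "ratio = \<rho> / (1 - \<rho>)"

definition decay :: real where "decay = \<rho> / sqrt ratio + (1 - \<rho>) * sqrt ratio"

text \<open>\<open>sqrt ratio\<close> minimises \<open>\<rho> / x + (1 - \<rho>) * x\<close> over \<open>x > 0\<close>, and the minimum is below \<open>1\<close>.\<close>

lemma ratio_pos: "0 < ratio" and ratio_less_1: "ratio < 1"
  using rho by (auto simp: ratio_def field_simps)

lemma decay_eq: "decay = 2 * sqrt (\<rho> * (1 - \<rho>))"
proof -
  define a b where "a = sqrt \<rho>" and "b = sqrt (1 - \<rho>)"
  then have ab: "a > 0" "b > 0" "\<rho> = a * a" "1 - \<rho> = b * b"
    using rho by auto
  have "sqrt ratio = a / b" and sq: "sqrt (\<rho> * (1 - \<rho>)) = a * b"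
    by (simp_all add: ratio_def real_sqrt_divide real_sqrt_mult a_def b_def)
  then have "decay = a * a / (a / b) + b * b * (a / b)"
    by (simp add: decay_def flip: ab(3,4))
  also have "\<dots> = 2 * (a * b)"
    using ab(1,2) by simp
  finally show ?thesis by (simp add: sq)
qed

lemma decay_pos: "0 < decay"
  using rho by (simp add: decay_eq)

lemma decay_less_1: "decay < 1"
proof -
  have "0 < (1 - 2 * \<rho>)\<^sup>2" using rho by simp
  then have "\<rho> * (1 - \<rho>) < (1 / 2)\<^sup>2" by (simp add: power2_eq_square algebra_simps)
  then have "sqrt (\<rho> * (1 - \<rho>)) < 1 / 2" by (intro real_less_lsqrt) auto
  then show ?thesis by (simp add: decay_eq)
qed

text \<open>The stationary tail is harmonic for the dual recursion
  \<open>queue_op_pow_at_least\<close>.\<close>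

lemma ratio_rec:
  assumes "v \<ge> 1"
  shows "\<rho> * ratio ^ (v - 1) + (1 - \<rho>) * ratio ^ (v + 1) = ratio ^ v"
proof -
  obtain u where v: "v = Suc u" using assms by (cases v) auto
  have "(1 - \<rho>) * ratio = \<rho>" "\<rho> + \<rho> * ratio = ratio"
    using rho by (simp_all add: ratio_def field_simps)
  then have "\<rho> + (1 - \<rho>) * ratio * ratio = ratio" by simp
  then have "ratio ^ u * (\<rho> + (1 - \<rho>) * ratio * ratio) = ratio ^ u * ratio" by simp
  then show ?thesis by (simp add: v algebra_simps)
qed

text \<open>An eigenfunction of the same recursion with eigenvalue \<open>decay\<close>, used to
  control the distance to the stationary tail.\<close>

lemma decay_rec:
  assumes "v \<ge> 1"
  shows "\<rho> * sqrt ratio ^ (v - 1) + (1 - \<rho>) * sqrt ratio ^ (v + 1) = decay * sqrt ratio ^ v"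
proof -
  obtain u where v: "v = Suc u" using assms by (cases v) auto
  define s where "s = sqrt ratio"
  have "s > 0" using ratio_pos by (simp add: s_def)
  then show ?thesis by (simp add: v decay_def field_simps flip: s_def)
qed

text \<open>Both sides obey the same recursion with nonnegative coefficients, so the comparison at
  time 0 persists.\<close>

lemma queue_tail_le: "(queue_op \<rho> ^^ t) (at_least v) 0 \<le> ratio ^ v"
proof (induction t arbitrary: v)
  case 0
  show ?case using ratio_pos by (cases v) auto
next
  case (Suc t)
  show ?case
  proof (cases "v = 0")
    case True
    then show ?thesis by (simp del: funpow.simps)
  next
    case False
    then have v: "v \<ge> 1" by simp
    show ?thesis
      unfolding queue_op_pow_at_least[OF v] ratio_rec[OF v, symmetric]
      using rho by (intro add_mono mult_left_mono Suc) auto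
  qed
qed

text \<open>The deficit from the stationary tail is at most \<open>sqrt ratio ^ v\<close> at time 0,
  and this eigenfunction shrinks by \<open>decay\<close> per step.\<close>

lemma queue_tail_ge:
  "ratio ^ v - decay ^ t * sqrt ratio ^ v \<le> (queue_op \<rho> ^^ t) (at_least v) 0"
proof (induction t arbitrary: v)
  case 0
  have "ratio = sqrt ratio * sqrt ratio" using ratio_pos by simp
  then have "ratio ^ v = sqrt ratio ^ v * sqrt ratio ^ v" by (metis power_mult_distrib)
  also have "\<dots> \<le> 1 * sqrt ratio ^ v"
    using ratio_pos ratio_less_1 by (intro mult_right_mono power_le_one) auto
  finally show ?case by simp
next
  case (Suc t)
  show ?case
  proof (cases "v = 0")
    case True
    then show ?thesis using decay_pos by (simp del: funpow.simps)
  next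
    case False
    then have v: "v \<ge> 1" by simp
    have "decay ^ Suc t * sqrt ratio ^ v = decay ^ t * (decay * sqrt ratio ^ v)" by simp
    then have "ratio ^ v - decay ^ Suc t * sqrt ratio ^ v =
      \<rho> * (ratio ^ (v - 1) - decay ^ t * sqrt ratio ^ (v - 1)) +
      (1 - \<rho>) * (ratio ^ (v + 1) - decay ^ t * sqrt ratio ^ (v + 1))"
      unfolding ratio_rec[OF v, symmetric] decay_rec[OF v, symmetric] by (simp add: algebra_simps)
    then show ?thesis
      unfolding queue_op_pow_at_least[OF v]
      using rho Suc[of "v - 1"] Suc[of "v + 1"] by (auto intro!: add_mono mult_left_mono)
  qed
qed

lemma queue_tail_tendsto: "(\<lambda>t. (queue_op \<rho> ^^ t) (at_least v) 0) \<longlonglongrightarrow> ratio ^ v"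
proof (rule tendsto_sandwich)
  have "(\<lambda>t. ratio ^ v - decay ^ t * sqrt ratio ^ v) \<longlonglongrightarrow> ratio ^ v - 0 * sqrt ratio ^ v"
    using decay_pos decay_less_1 by (intro tendsto_intros LIMSEQ_realpow_zero) auto
  then show "(\<lambda>t. ratio ^ v - decay ^ t * sqrt ratio ^ v) \<longlonglongrightarrow> ratio ^ v" by simp
  show "(\<lambda>t. ratio ^ v) \<longlonglongrightarrow> ratio ^ v" by simp
qed (use queue_tail_le queue_tail_ge in auto)

section \<open>Reversibility and the geometric stationary law\<close>

definition equilibrium :: "(nat \<Rightarrow> real) \<Rightarrow> real" where
  "equilibrium f = (\<Sum>w. (1 - ratio) * (ratio ^ w * f w))"

lemma summable_ratio_mult:
  assumes "\<And>w. \<bar>f w\<bar> \<le> 1"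
  shows "summable (\<lambda>w. ratio ^ w * f w)"
proof (rule summable_comparison_test)
  show "\<exists>N. \<forall>n\<ge>N. norm (ratio ^ n * f n) \<le> ratio ^ n"
    using assms ratio_pos by (auto simp: abs_mult mult_left_le)
  show "summable ((^) ratio)" using ratio_pos ratio_less_1 by (intro summable_geometric) simp
qed

lemma equilibrium_sums:
  assumes "\<And>w. \<bar>f w\<bar> \<le> 1"
  shows "(\<lambda>w. (1 - ratio) * (ratio ^ w * f w)) sums equilibrium f"
  unfolding equilibrium_def by (intro summable_sums summable_mult summable_ratio_mult assms)

lemma equilibrium_1: "equilibrium (\<lambda>_. 1) = 1"
proof -
  have "(\<lambda>w. (1 - ratio) * ratio ^ w) sums ((1 - ratio) * (1 / (1 - ratio)))"
    using ratio_pos ratio_less_1 by (intro sums_mult geometric_sums) simp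
  then show ?thesis using ratio_less_1 by (simp add: equilibrium_def sums_iff)
qed

lemma equilibrium_lincomb:
  assumes "\<And>w. \<bar>f w\<bar> \<le> 1" "\<And>w. \<bar>g w\<bar> \<le> 1"
  shows "equilibrium (\<lambda>w. a * f w + b * g w) = a * equilibrium f + b * equilibrium g"
proof -
  have "(\<lambda>w. a * ((1 - ratio) * (ratio ^ w * f w)) + b * ((1 - ratio) * (ratio ^ w * g w)))
    sums (a * equilibrium f + b * equilibrium g)"
    by (intro sums_add sums_mult equilibrium_sums assms)
  then show ?thesis by (simp add: equilibrium_def sums_iff algebra_simps)
qed

lemma equilibrium_zero_mult:
  assumes "\<And>w. \<bar>f w\<bar> \<le> 1"
  shows "equilibrium (\<lambda>w. of_bool (w = 0) * f w) = (1 - ratio) * f 0"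
proof -
  have "(\<lambda>w. if w = 0 then (1 - ratio) * f w else 0) sums ((1 - ratio) * f 0)"
    using sums_If_finite_set[of "{0}" "\<lambda>w. (1 - ratio) * f w"] by simp
  moreover have "(\<lambda>w. (1 - ratio) * (ratio ^ w * (of_bool (w = 0) * f w))) =
      (\<lambda>w. if w = 0 then (1 - ratio) * f w else 0)" by auto
  ultimately show ?thesis by (simp add: equilibrium_def sums_iff)
qed

text \<open>Reversibility: \<open>(1 - \<rho>) * ratio = \<rho>\<close> is detailed balance.\<close>

lemma equilibrium_queue_op:
  assumes "\<And>w. \<bar>f w\<bar> \<le> 1" "\<And>w. \<bar>g w\<bar> \<le> 1"
  shows "equilibrium (\<lambda>w. f w * queue_op \<rho> g w) =
    (1 - ratio) * (\<rho> * (\<Sum>w. ratio ^ w * (f w * g (w + 1)) + ratio ^ w * (f (w + 1) * g w)) + (1 - \<rho>) * (f 0 * g 0))"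
proof -
  define S where "S = (\<Sum>w. ratio ^ w * (f w * g (w + 1)))"
  define S' where "S' = (\<Sum>w. ratio ^ w * (f (w + 1) * g w))"
  have S: "(\<lambda>w. ratio ^ w * (f w * g (w + 1))) sums S"
    and S': "(\<lambda>w. ratio ^ w * (f (w + 1) * g w)) sums S'"
    unfolding S_def S'_def by (intro summable_sums summable_ratio_mult abs_mult_le_1 assms)+
  have bal: "(1 - \<rho>) * ratio = \<rho>" using rho by (simp add: ratio_def)
  have "(\<lambda>w. \<rho> * (ratio ^ w * (f (w + 1) * g w))) sums (\<rho> * S')"
    by (intro sums_mult S')
  \<comment> \<open>Detailed balance absorbs the weight in the shift from \<open>w\<close> to
    \<open>Suc w\<close>; \<open>sums_Suc_iff\<close> then adds the term at 0, where reflection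
    gives \<open>f 0 * g 0\<close>.\<close>
  also have "(\<lambda>w. \<rho> * (ratio ^ w * (f (w + 1) * g w))) =
    (\<lambda>w. (1 - \<rho>) * (ratio ^ Suc w * (f (Suc w) * g (Suc w - 1))))"
    by (subst bal[symmetric]) (simp add: fun_eq_iff)
  finally have "(\<lambda>w. (1 - \<rho>) * (ratio ^ w * (f w * g (w - 1)))) sums (\<rho> * S' + (1 - \<rho>) * (f 0 * g 0))"
    by (subst (asm) sums_Suc_iff) simp
  from sums_add[OF sums_mult[OF S, of \<rho>] this]
  have "(\<lambda>w. ratio ^ w * (f w * queue_op \<rho> g w)) sums (\<rho> * S + (\<rho> * S' + (1 - \<rho>) * (f 0 * g 0)))"
    by (simp add: queue_op_def algebra_simps)
  then have "equilibrium (\<lambda>w. f w * queue_op \<rho> g w) = (1 - ratio) * (\<rho> * S + (\<rho> * S' + (1 - \<rho>) * (f 0 * g 0)))"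
    unfolding equilibrium_def by (intro sums_unique[symmetric] sums_mult)
  moreover have "(\<Sum>w. ratio ^ w * (f w * g (w + 1)) + ratio ^ w * (f (w + 1) * g w)) = S + S'"
    by (intro sums_unique[symmetric] sums_add S S')
  ultimately show ?thesis by (simp add: algebra_simps)
qed

text \<open>The expression in \<open>equilibrium_queue_op\<close> is symmetric in \<open>f\<close>
  and \<open>g\<close>.\<close>

lemma equilibrium_self_adjoint:
  assumes "\<And>w. \<bar>f w\<bar> \<le> 1" "\<And>w. \<bar>g w\<bar> \<le> 1"
  shows "equilibrium (\<lambda>w. f w * queue_op \<rho> g w) = equilibrium (\<lambda>w. g w * queue_op \<rho> f w)"
  unfolding equilibrium_queue_op[OF assms] equilibrium_queue_op[OF assms(2,1)]
  by (simp add: algebra_simps)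

lemma equilibrium_self_adjoint_pow:
  assumes "\<And>w. \<bar>f w\<bar> \<le> 1" "\<And>w. \<bar>g w\<bar> \<le> 1"
  shows "equilibrium (\<lambda>w. f w * (queue_op \<rho> ^^ t) g w) = equilibrium (\<lambda>w. g w * (queue_op \<rho> ^^ t) f w)"
  using assms
proof (induction t arbitrary: f g)
  case (Suc t)
  have *: "\<bar>(queue_op \<rho> ^^ t) g w\<bar> \<le> 1" "\<bar>queue_op \<rho> f w\<bar> \<le> 1" for w
    using rho Suc.prems by (auto intro!: queue_op_pow_abs_le queue_op_abs_le)
  have "equilibrium (\<lambda>w. f w * (queue_op \<rho> ^^ Suc t) g w) =
      equilibrium (\<lambda>w. queue_op \<rho> f w * (queue_op \<rho> ^^ t) g w)"
    using equilibrium_self_adjoint[of f "(queue_op \<rho> ^^ t) g"] Suc.prems * by (simp add: mult.commute)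
  also have "\<dots> = equilibrium (\<lambda>w. g w * (queue_op \<rho> ^^ Suc t) f w)"
    unfolding funpow_Suc_right comp_def by (intro Suc.IH Suc.prems *)
  finally show ?case .
qed (simp add: mult.commute)

text \<open>Self-adjointness against the constant 1 is stationarity. With the parity flip it makes
  the value \<open>x\<close> satisfy \<open>x = 1 - x - (1 - \<rho>) * (1 - ratio)\<close>, where
  the last product is \<open>1 - 2 * \<rho>\<close>.\<close>

lemma equilibrium_odd: "equilibrium odd_ind = \<rho>"
proof -
  have "equilibrium odd_ind = equilibrium (\<lambda>w. odd_ind w * queue_op \<rho> (\<lambda>_. 1) w)"
    by (simp add: queue_op_def)
  also have "\<dots> = equilibrium (\<lambda>w. 1 * queue_op \<rho> odd_ind w)"
    by (intro equilibrium_self_adjoint) auto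
  also have "\<dots> = equilibrium (\<lambda>w. 1 * (1 - odd_ind w) + - (1 - \<rho>) * (of_bool (w = 0) * 1))"
    by (simp add: queue_op_odd)
  also have "\<dots> = 1 * equilibrium (\<lambda>w. 1 - odd_ind w) + - (1 - \<rho>) * equilibrium (\<lambda>w. of_bool (w = 0) * 1)"
    by (intro equilibrium_lincomb) auto
  also have "equilibrium (\<lambda>w. of_bool (w = 0) * 1) = 1 - ratio"
    by (subst equilibrium_zero_mult) auto
  also have "equilibrium (\<lambda>w. 1 - odd_ind w) = equilibrium (\<lambda>w. 1 * 1 + - 1 * odd_ind w)"
    by simp
  also have "\<dots> = 1 * equilibrium (\<lambda>_. 1) + - 1 * equilibrium odd_ind"
    by (intro equilibrium_lincomb) auto
  finally have "2 * equilibrium odd_ind = 1 - (1 - \<rho>) * (1 - ratio)"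
    by (simp add: equilibrium_1 left_diff_distrib)
  also have "\<dots> = 2 * \<rho>"
    using rho by (simp add: ratio_def field_simps)
  finally show ?thesis by simp
qed

text \<open>Point probabilities are differences of tails, hence converge; being at most
  \<open>ratio ^ v\<close> uniformly in \<open>t\<close>, they allow dominated convergence.\<close>

lemma queue_op_pow_tendsto_equilibrium:
  assumes "\<And>w. \<bar>f w\<bar> \<le> 1"
  shows "(\<lambda>t. (queue_op \<rho> ^^ t) f 0) \<longlonglongrightarrow> equilibrium f"
proof -
  define p where "p t v = (queue_op \<rho> ^^ t) (\<lambda>w. of_bool (w = v)) 0" for t v
  have p: "p t v = (queue_op \<rho> ^^ t) (at_least v) 0 - (queue_op \<rho> ^^ t) (at_least (v + 1)) 0" for t v
  proof -
    have "(\<lambda>w. of_bool (w = v)) = (\<lambda>w. 1 * at_least v w + -1 * at_least (v + 1) w)"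
      by (auto simp: fun_eq_iff)
    then show ?thesis by (simp only: p_def queue_op_pow_lincomb)
  qed
  have nonneg: "0 \<le> (queue_op \<rho> ^^ t) (\<lambda>w. of_bool (P w)) w" for t P w
    by (induction t arbitrary: w) (use rho in \<open>auto simp: queue_op_def\<close>)
  have bound: "norm (f v * p t v) \<le> ratio ^ v" for t v
  proof -
    have "\<bar>p t v\<bar> \<le> ratio ^ v"
      using nonneg[of t "\<lambda>w. w = v" 0] nonneg[of t "\<lambda>w. v + 1 \<le> w" 0] queue_tail_le[of t v]
      by (auto simp: p[of t v] simp flip: p_def)
    then have "\<bar>f v\<bar> * \<bar>p t v\<bar> \<le> 1 * ratio ^ v"
      by (intro mult_mono assms) auto
    then show ?thesis by (simp add: abs_mult)
  qed
  have lim: "(\<lambda>t. f v * p t v) \<longlonglongrightarrow> (1 - ratio) * (ratio ^ v * f v)" for v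
  proof -
    have "(\<lambda>t. f v * p t v) \<longlonglongrightarrow> f v * (ratio ^ v - ratio ^ (v + 1))"
      unfolding p by (intro tendsto_intros queue_tail_tendsto)
    then show ?thesis by (simp add: algebra_simps)
  qed
  have geo: "summable (\<lambda>v. norm (ratio ^ v))"
    using ratio_pos ratio_less_1 by (simp add: summable_geometric)
  \<comment> \<open>The series are written as integrals over the counting measure to apply dominated
    convergence.\<close>
  have sum: "(\<lambda>t. integral\<^sup>L (count_space UNIV) (\<lambda>v. f v * p t v))
      \<longlonglongrightarrow> integral\<^sup>L (count_space UNIV) (\<lambda>v. (1 - ratio) * (ratio ^ v * f v))"
    using geo lim bound
    by (intro integral_dominated_convergence[where w = "\<lambda>v. ratio ^ v"])
       (auto simp: integrable_count_space_nat_iff AE_count_space)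
  have "integral\<^sup>L (count_space UNIV) (\<lambda>v. f v * p t v) = (queue_op \<rho> ^^ t) f 0" for t
  proof -
    have "summable (\<lambda>v. norm (f v * p t v))"
      using geo by (rule summable_comparison_test[rotated]) (use bound ratio_pos in auto)
    then show ?thesis
      using queue_op_pow_sums[of f t \<rho> 0]
      by (simp add: integral_count_space_nat integrable_count_space_nat_iff sums_iff flip: p_def)
  qed
  moreover have "integral\<^sup>L (count_space UNIV) (\<lambda>v. (1 - ratio) * (ratio ^ v * f v)) = equilibrium f"
  proof -
    have "summable (\<lambda>v. norm ((1 - ratio) * (ratio ^ v * f v)))"
      using summable_mult[OF summable_ratio_mult[of "\<lambda>v. \<bar>f v\<bar>"], of "\<bar>1 - ratio\<bar>"] assms ratio_pos
      by (simp add: abs_mult)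
    then show ?thesis
      unfolding equilibrium_def
      by (intro integral_count_space_nat) (simp only: integrable_count_space_nat_iff)
  qed
  ultimately show ?thesis using sum by simp
qed

text \<open>By the parity flip the two terms add up to the density \<rho> minus a holding
  correction: odd now, at 0 after \<open>2 * n + 1\<close> steps, then a hole. Reversed in time, the
  correction starts at 0 and is known from \<open>queue_op_pow_odd_at_0\<close>.\<close>

lemma equilibrium_two_point_sum:
  "equilibrium (\<lambda>w. odd_ind w * (queue_op \<rho> ^^ (2 * n + 1)) odd_ind w) +
   equilibrium (\<lambda>w. odd_ind w * (queue_op \<rho> ^^ (2 * n + 2)) odd_ind w) = 2 * \<rho>\<^sup>2"
proof -
  let ?T = "queue_op \<rho> ^^ (2 * n + 1)" and ?z = "\<lambda>w::nat. of_bool (w = 0) :: real"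
  have bd: "\<bar>odd_ind w * (queue_op \<rho> ^^ t) (\<lambda>w. of_bool (P w)) w\<bar> \<le> 1" for w t P
    using rho by (intro abs_mult_le_1 queue_op_pow_abs_le) auto
  have "equilibrium (\<lambda>w. odd_ind w * ?T odd_ind w) +
      equilibrium (\<lambda>w. odd_ind w * (queue_op \<rho> ^^ (2 * n + 2)) odd_ind w) =
    equilibrium (\<lambda>w. 1 * (odd_ind w * ?T odd_ind w) + 1 * (odd_ind w * (queue_op \<rho> ^^ (2 * n + 2)) odd_ind w))"
    by (subst equilibrium_lincomb[OF bd bd]) simp
  also have "(\<lambda>w. 1 * (odd_ind w * ?T odd_ind w) + 1 * (odd_ind w * (queue_op \<rho> ^^ (2 * n + 2)) odd_ind w)) =
      (\<lambda>w. 1 * odd_ind w + - (1 - \<rho>) * (odd_ind w * ?T ?z w))"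
    using queue_op_pow_Suc_odd[of "2 * n + 1" \<rho>] by (auto simp: fun_eq_iff algebra_simps simp del: funpow.simps)
  also have "equilibrium \<dots> = 1 * equilibrium odd_ind + - (1 - \<rho>) * equilibrium (\<lambda>w. odd_ind w * ?T ?z w)"
    by (rule equilibrium_lincomb[OF _ bd]) auto
  also have "equilibrium (\<lambda>w. odd_ind w * ?T ?z w) = equilibrium (\<lambda>w. ?z w * ?T odd_ind w)"
    by (intro equilibrium_self_adjoint_pow) auto
  also have "\<dots> = (1 - ratio) * ?T odd_ind 0"
    using rho by (intro equilibrium_zero_mult queue_op_pow_abs_le) auto
  also have "\<dots> = (1 - ratio) * \<rho>"
    by (simp only: queue_op_pow_odd_at_0)
  also have "1 * equilibrium odd_ind + - (1 - \<rho>) * ((1 - ratio) * \<rho>) = 2 * \<rho>\<^sup>2"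
    using rho by (simp add: equilibrium_odd ratio_def field_simps power2_eq_square)
  finally show ?thesis .
qed

section \<open>Almost sure behaviour and expectations\<close>

abbreviation "M \<equiv> bernoulli_measure \<rho>"

lemma prob_space_bernoulli: "prob_space M"
  unfolding bernoulli_measure_def by (intro prob_space_PiM prob_space_measure_pmf)

interpretation prob_space M by (rule prob_space_bernoulli)

lemma emeasure_UNIV [simp]: "emeasure M UNIV = 1"
  using emeasure_space_1 by simp

lemma prob_UNIV [simp]: "prob UNIV = 1"
  using prob_space by simp

text \<open>Independence of the sites enters the expectations through this invariance under
  resampling one site.\<close>

lemma distr_resample: "distr (measure_pmf (bernoulli_pmf \<rho>) \<Otimes>\<^sub>M M) M (\<lambda>(b, \<eta>). \<eta>(i := b)) = M"
  using distr_pair_PiM_eq_PiM[of UNIV "\<lambda>_. measure_pmf (bernoulli_pmf \<rho>)" i]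
  by (simp add: bernoulli_measure_def prob_space_measure_pmf)

lemma measurable_resample:
  "(\<lambda>(b, \<eta>). \<eta>(i := b)) \<in> measure_pmf (bernoulli_pmf \<rho>) \<Otimes>\<^sub>M M \<rightarrow>\<^sub>M M"
  unfolding bernoulli_measure_def
  using measurable_fun_upd[where I = "UNIV :: int set" and J = UNIV and i = i]
  by measurable

lemma measurable_upd [measurable]: "(\<lambda>\<eta>. \<eta>(i := b)) \<in> M \<rightarrow>\<^sub>M M"
  using measurable_compose[OF measurable_Pair1' measurable_resample[of i], of b] by simp

lemma nn_integral_resample:
  assumes [measurable]: "f \<in> borel_measurable M"
  shows "(\<integral>\<^sup>+\<eta>. f \<eta> \<partial>M) =
    (\<integral>\<^sup>+\<eta>. ennreal \<rho> * f (\<eta>(i := True)) + ennreal (1 - \<rho>) * f (\<eta>(i := False)) \<partial>M)"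
proof -
  have [measurable]: "(\<lambda>(b, \<eta>). \<eta>(i := b)) \<in> measure_pmf (bernoulli_pmf \<rho>) \<Otimes>\<^sub>M M \<rightarrow>\<^sub>M M"
    by (rule measurable_resample)
  have "(\<integral>\<^sup>+\<eta>. f \<eta> \<partial>M) = (\<integral>\<^sup>+x. f ((\<lambda>(b, \<eta>). \<eta>(i := b)) x) \<partial>(measure_pmf (bernoulli_pmf \<rho>) \<Otimes>\<^sub>M M))"
    by (subst distr_resample[of i, symmetric]) (simp add: nn_integral_distr)
  also have "\<dots> = (\<integral>\<^sup>+b. \<integral>\<^sup>+\<eta>. f (\<eta>(i := b)) \<partial>M \<partial>measure_pmf (bernoulli_pmf \<rho>))"
    by (subst nn_integral_fst[symmetric]) auto
  also have "\<dots> = ennreal \<rho> * (\<integral>\<^sup>+\<eta>. f (\<eta>(i := True)) \<partial>M) + ennreal (1 - \<rho>) * (\<integral>\<^sup>+\<eta>. f (\<eta>(i := False)) \<partial>M)"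
    using rho by (simp add: mult.commute)
  also have "\<dots> = (\<integral>\<^sup>+\<eta>. ennreal \<rho> * f (\<eta>(i := True)) + ennreal (1 - \<rho>) * f (\<eta>(i := False)) \<partial>M)"
    by (simp add: nn_integral_add nn_integral_cmult)
  finally show ?thesis .
qed

lemma integral_resample:
  fixes f :: "config \<Rightarrow> real"
  assumes [measurable]: "f \<in> borel_measurable M" and "\<And>\<eta>. \<bar>f \<eta>\<bar> \<le> 1"
  shows "(\<integral>\<eta>. f \<eta> \<partial>M) = (\<integral>\<eta>. \<rho> * f (\<eta>(i := True)) + (1 - \<rho>) * f (\<eta>(i := False)) \<partial>M)"
proof -
  have [measurable]: "(\<lambda>(b, \<eta>). \<eta>(i := b)) \<in> measure_pmf (bernoulli_pmf \<rho>) \<Otimes>\<^sub>M M \<rightarrow>\<^sub>M M"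
    by (rule measurable_resample)
  have int: "integrable M (\<lambda>\<eta>. f (\<eta>(i := b)))" for b
    by (rule integrable_const_bound[where B = 1]) (use assms(2) in auto)
  interpret pair_prob_space "measure_pmf (bernoulli_pmf \<rho>)" M ..
  have "(\<integral>\<eta>. f \<eta> \<partial>M) = (\<integral>x. f ((\<lambda>(b, \<eta>). \<eta>(i := b)) x) \<partial>(measure_pmf (bernoulli_pmf \<rho>) \<Otimes>\<^sub>M M))"
    by (subst distr_resample[of i, symmetric]) (simp add: integral_distr)
  also have "\<dots> = (\<integral>b. \<integral>\<eta>. f (\<eta>(i := b)) \<partial>M \<partial>measure_pmf (bernoulli_pmf \<rho>))"
    by (subst integral_fst'[symmetric]) (auto intro!: P.integrable_const_bound[where B = 1] simp: assms(2) split_beta')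
  also have "\<dots> = \<rho> * (\<integral>\<eta>. f (\<eta>(i := True)) \<partial>M) + (1 - \<rho>) * (\<integral>\<eta>. f (\<eta>(i := False)) \<partial>M)"
    using rho by (simp add: mult.commute)
  also have "\<dots> = (\<integral>\<eta>. \<rho> * f (\<eta>(i := True)) + (1 - \<rho>) * f (\<eta>(i := False)) \<partial>M)"
    using int by simp
  finally show ?thesis .
qed

text \<open>The Markov property: \<open>G\<close> sees only sites up to \<open>s\<close>, so
  averaging over the last site leaves \<open>G\<close> alone and applies \<open>queue_op\<close> to
  \<open>f\<close>. Sites are removed from the right, which is why \<open>f\<close> varies in the
  induction.\<close>

lemma expectation_queue_Markov:
  fixes G :: "config \<Rightarrow> real"
  assumes [measurable]: "G \<in> borel_measurable M" and G_le: "\<And>\<eta>. \<bar>G \<eta>\<bar> \<le> 1"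
    and G_upd: "\<And>\<eta> i b. s < i \<Longrightarrow> G (\<eta>(i := b)) = G \<eta>"
    and f: "\<And>w. \<bar>f w\<bar> \<le> 1"
  shows "(\<integral>\<eta>. G \<eta> * f (queue \<eta> (s + int k) (m + k)) \<partial>M) =
    (\<integral>\<eta>. G \<eta> * (queue_op \<rho> ^^ k) f (queue \<eta> s m) \<partial>M)"
  using f
proof (induction k arbitrary: f)
  case (Suc k)
  let ?i = "s + int (Suc k)"
  have i: "?i - 1 = s + int k" by simp
  have q: "queue (\<eta>(?i := b)) ?i (m + Suc k) = queue_step b (queue \<eta> (s + int k) (m + k))" for \<eta> b
    by (simp only: add_Suc_right queue.simps(2) i fun_upd_same) (simp add: queue_fun_upd)
  have "(\<integral>\<eta>. G \<eta> * f (queue \<eta> ?i (m + Suc k)) \<partial>M) =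
    (\<integral>\<eta>. \<rho> * (G (\<eta>(?i := True)) * f (queue (\<eta>(?i := True)) ?i (m + Suc k))) +
      (1 - \<rho>) * (G (\<eta>(?i := False)) * f (queue (\<eta>(?i := False)) ?i (m + Suc k))) \<partial>M)"
    using G_le Suc.prems by (intro integral_resample abs_mult_le_1) measurable
  also have "\<dots> = (\<integral>\<eta>. G \<eta> * queue_op \<rho> f (queue \<eta> (s + int k) (m + k)) \<partial>M)"
    unfolding q by (subst (1 2) G_upd) (simp_all add: queue_op_def queue_step_def algebra_simps)
  also have "\<dots> = (\<integral>\<eta>. G \<eta> * (queue_op \<rho> ^^ Suc k) f (queue \<eta> s m) \<partial>M)"
    unfolding funpow_Suc_right comp_def
    using rho Suc.prems by (intro Suc.IH queue_op_abs_le) auto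
  finally show ?case .
qed simp

lemma expectation_queue:
  assumes "\<And>w. \<bar>f w\<bar> \<le> 1"
  shows "(\<integral>\<eta>. f (queue \<eta> s m) \<partial>M) = (queue_op \<rho> ^^ m) f 0"
  using expectation_queue_Markov[of "\<lambda>_. 1" "s - int m" f m 0] assms
  by simp

section \<open>Almost sure boundedness of the walk and unboundedness of the heights\<close>

text \<open>The events increase with \<open>m\<close> and each obeys the tail bound, so continuity
  from below gives the bound for their union.\<close>

lemma prob_queue_ge: "prob {\<eta>. \<exists>m. v \<le> queue \<eta> s m} \<le> ratio ^ v"
proof -
  define A where "A m = {\<eta>. v \<le> queue \<eta> s m}" for m
  have A: "A m \<in> events" for m
  proof -
    have "{\<eta> \<in> space M. v \<le> queue \<eta> s m} \<in> events" by measurable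
    then show ?thesis by (simp add: A_def)
  qed
  have "prob (A m) \<le> ratio ^ v" for m
  proof -
    have "prob (A m) = (\<integral>\<eta>. indicator (A m) \<eta> \<partial>M)" using A by simp
    also have "(\<lambda>\<eta>. indicator (A m) \<eta> :: real) = (\<lambda>\<eta>. at_least v (queue \<eta> s m))"
      by (auto simp: A_def indicator_def)
    also have "(\<integral>\<eta>. at_least v (queue \<eta> s m) \<partial>M) = (queue_op \<rho> ^^ m) (at_least v) 0"
      by (intro expectation_queue) auto
    also have "\<dots> \<le> ratio ^ v" by (rule queue_tail_le)
    finally show ?thesis .
  qed
  moreover have "incseq A"
  proof (rule incseq_SucI)
    show "A m \<le> A (Suc m)" for m
      using incseq_SucD[OF queue_incseq] by (auto simp: A_def intro: order_trans)
  qed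
  then have "(\<lambda>m. prob (A m)) \<longlonglongrightarrow> prob (\<Union>m. A m)"
    using A by (intro finite_Lim_measure_incseq) auto
  ultimately have "prob (\<Union>m. A m) \<le> ratio ^ v"
    by (intro LIMSEQ_le_const2) auto
  also have "(\<Union>m. A m) = {\<eta>. \<exists>m. v \<le> queue \<eta> s m}" by (auto simp: A_def)
  finally show ?thesis .
qed

lemma AE_queue_bounded: "AE \<eta> in M. \<forall>s. \<exists>B. \<forall>m. queue \<eta> s m \<le> B"
proof -
  have "AE \<eta> in M. \<exists>B. \<forall>m. queue \<eta> s m \<le> B" for s
  proof -
    let ?N = "{\<eta> \<in> space M. \<not> (\<exists>B. \<forall>m. queue \<eta> s m \<le> B)}"
    have N: "?N \<in> events" by measurable
    have "prob ?N \<le> ratio ^ v" for v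
    proof -
      have "{\<eta> \<in> space M. \<exists>m. v \<le> queue \<eta> s m} \<in> events" by measurable
      then have "prob ?N \<le> prob {\<eta>. \<exists>m. v \<le> queue \<eta> s m}"
        by (intro finite_measure_mono) (auto simp: not_le intro: less_imp_le)
      with prob_queue_ge[of v s] show ?thesis by simp
    qed
    moreover have "(\<lambda>v. ratio ^ v) \<longlonglongrightarrow> 0"
      using ratio_pos ratio_less_1 by (intro LIMSEQ_realpow_zero) auto
    ultimately have "prob ?N \<le> 0"
      by (intro LIMSEQ_le_const) auto
    then show ?thesis
      using N by (intro AE_I[of _ _ ?N]) (auto simp: emeasure_eq_measure measure_le_0_iff)
  qed
  then show ?thesis by (simp add: AE_all_countable)
qed

text \<open>An exponential moment of a sum of independent steps: each site contributes the factor
  \<open>decay\<close>.\<close>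

lemma nn_integral_height_powi:
  "(\<integral>\<^sup>+\<eta>. ennreal (sqrt ratio powi height \<eta> (int n)) \<partial>M) = ennreal (decay ^ n)"
proof (induction n)
  case 0
  show ?case by simp
next
  case (Suc n)
  let ?x = "sqrt ratio" and ?i = "int n + 1"
  have x: "?x > 0" using ratio_pos by simp
  have step: "\<rho> * ?x powi (h - 1) + (1 - \<rho>) * ?x powi (h + 1) = decay * ?x powi h" for h
  proof -
    define y where "y = ?x"
    have "y > 0" using x by (simp add: y_def)
    then show ?thesis
      by (simp add: decay_def power_int_add power_int_diff field_simps flip: y_def)
  qed
  have upd: "height (\<eta>(?i := b)) ?i = height \<eta> (int n) + (if b then -1 else 1)" for \<eta> b
  proof -
    have "height (\<eta>(?i := b)) (int n) = height \<eta> (int n)"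
      by (simp add: height_def)
    then show ?thesis using height_Suc[of "\<eta>(?i := b)" "int n"] by simp
  qed
  have "(\<integral>\<^sup>+\<eta>. ennreal (?x powi height \<eta> ?i) \<partial>M) =
    (\<integral>\<^sup>+\<eta>. ennreal \<rho> * ennreal (?x powi height (\<eta>(?i := True)) ?i) +
       ennreal (1 - \<rho>) * ennreal (?x powi height (\<eta>(?i := False)) ?i) \<partial>M)"
    by (intro nn_integral_resample) measurable
  also have "\<dots> = (\<integral>\<^sup>+\<eta>. ennreal (decay) * ennreal (?x powi height \<eta> (int n)) \<partial>M)"
  proof (rule nn_integral_cong)
    fix \<eta> :: config
    have "ennreal \<rho> * ennreal (?x powi (height \<eta> (int n) - 1)) +
        ennreal (1 - \<rho>) * ennreal (?x powi (height \<eta> (int n) + 1)) =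
      ennreal (\<rho> * ?x powi (height \<eta> (int n) - 1) + (1 - \<rho>) * ?x powi (height \<eta> (int n) + 1))"
      using rho x by (simp flip: ennreal_mult ennreal_plus)
    also have "\<dots> = ennreal (decay * ?x powi height \<eta> (int n))"
      unfolding step ..
    also have "\<dots> = ennreal (decay) * ennreal (?x powi height \<eta> (int n))"
      using x decay_pos by (intro ennreal_mult) auto
    finally show "ennreal \<rho> * ennreal (?x powi height (\<eta>(?i := True)) ?i) +
        ennreal (1 - \<rho>) * ennreal (?x powi height (\<eta>(?i := False)) ?i) =
      ennreal (decay) * ennreal (?x powi height \<eta> (int n))"
      by (simp add: upd)
  qed
  also have "\<dots> = ennreal (decay) * (\<integral>\<^sup>+\<eta>. ennreal (?x powi height \<eta> (int n)) \<partial>M)"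
    by (rule nn_integral_cmult) measurable
  also have "\<dots> = ennreal (decay ^ Suc n)"
    unfolding Suc using decay_pos by (simp flip: ennreal_mult)
  finally show ?case by (simp add: add.commute)
qed

text \<open>A Chernoff bound: where all heights are at most \<open>B\<close>, the power is at least
  \<open>sqrt ratio powi B\<close>, as \<open>sqrt ratio < 1\<close>, while its expectation at site
  \<open>n\<close> tends to 0.\<close>

lemma AE_height_unbounded: "AE \<eta> in M. \<forall>B. \<exists>i. height \<eta> i > B"
proof -
  let ?x = "sqrt ratio"
  have x: "0 < ?x" "?x < 1" using ratio_pos ratio_less_1 by auto
  have "AE \<eta> in M. \<exists>i. height \<eta> i > B" for B
  proof -
    let ?N = "{\<eta> \<in> space M. \<not> (\<exists>i. height \<eta> i > B)}"
    have N: "?N \<in> events" by measurable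
    have "?x powi B * prob ?N \<le> decay ^ n" for n
    proof -
      have "ennreal (?x powi B) * emeasure M ?N = (\<integral>\<^sup>+\<eta>. ennreal (?x powi B) * indicator ?N \<eta> \<partial>M)"
        using N by (simp add: nn_integral_cmult_indicator)
      also have "\<dots> \<le> (\<integral>\<^sup>+\<eta>. ennreal (?x powi height \<eta> (int n)) \<partial>M)"
        using x by (intro nn_integral_mono) (auto simp: indicator_def not_less intro!: ennreal_leI power_int_decreasing)
      also have "\<dots> = ennreal (decay ^ n)" by (rule nn_integral_height_powi)
      finally show ?thesis
        using x decay_pos by (simp add: emeasure_eq_measure flip: ennreal_mult)
    qed
    moreover have "(\<lambda>n. decay ^ n) \<longlonglongrightarrow> 0"
      using decay_pos decay_less_1 by (intro LIMSEQ_realpow_zero) auto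
    ultimately have "?x powi B * prob ?N \<le> 0"
      by (intro LIMSEQ_le_const) auto
    moreover have "?x powi B > 0"
      using x by (intro zero_less_power_int)
    ultimately have "prob ?N \<le> 0"
      using mult_pos_pos[of "?x powi B" "prob ?N"] by linarith
    then show ?thesis
      using N by (intro AE_I[of _ _ ?N]) (auto simp: emeasure_eq_measure measure_le_0_iff)
  qed
  then show ?thesis by (simp add: AE_all_countable)
qed

lemma AE_final_eq_odd_queue:
  "AE \<eta> in M. \<forall>k. \<forall>\<^sub>F m in sequentially. final \<eta> k = odd_ind (queue \<eta> k m)"
  using AE_queue_bounded AE_height_unbounded
proof eventually_elim
  case (elim \<eta>)
  then show ?case using final_eq_odd_queue[of \<eta>] by auto
qed

section \<open>The two-point function and the conditioned density\<close>

text \<open>The final values are replaced by parities of walks with a finite start. The Markov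
  property turns the expectation into \<open>m\<close> steps from 0 applied to a fixed function, and
  \<open>m\<close> tends to infinity.\<close>

lemma two_point_eq_equilibrium:
  "two_point \<rho> (int k) = equilibrium (\<lambda>w. odd_ind w * (queue_op \<rho> ^^ k) odd_ind w)"
proof (rule LIMSEQ_unique)
  \<comment> \<open>Both walks start at site \<open>- int m\<close>, hence the length
    \<open>m + k\<close> at site \<open>k\<close>.\<close>
  let ?F = "\<lambda>m \<eta>. odd_ind (queue \<eta> 0 m) * odd_ind (queue \<eta> (int k) (m + k))"
  have "AE \<eta> in M. (\<lambda>m. ?F m \<eta>) \<longlonglongrightarrow> final \<eta> 0 * final \<eta> (int k)"
    using AE_final_eq_odd_queue
  proof eventually_elim
    case (elim \<eta>)
    have "\<forall>\<^sub>F m in sequentially. final \<eta> (int k) = odd_ind (queue \<eta> (int k) (m + k))"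
      using elim by (subst eventually_sequentially_seg) simp
    moreover have "\<forall>\<^sub>F m in sequentially. final \<eta> 0 = odd_ind (queue \<eta> 0 m)"
      using elim by simp
    ultimately have "\<forall>\<^sub>F m in sequentially. ?F m \<eta> = final \<eta> 0 * final \<eta> (int k)"
      by eventually_elim simp
    then show ?case by (rule tendsto_eventually)
  qed
  then show "(\<lambda>m. \<integral>\<eta>. ?F m \<eta> \<partial>M) \<longlonglongrightarrow> two_point \<rho> (int k)"
    unfolding two_point_def
    by (intro integral_dominated_convergence[where w = "\<lambda>_. 1"]) auto
  have "(\<integral>\<eta>. ?F m \<eta> \<partial>M) = (queue_op \<rho> ^^ m) (\<lambda>w. odd_ind w * (queue_op \<rho> ^^ k) odd_ind w) 0" for m
  proof -
    have "(\<integral>\<eta>. ?F m \<eta> \<partial>M) = (\<integral>\<eta>. odd_ind (queue \<eta> 0 m) * (queue_op \<rho> ^^ k) odd_ind (queue \<eta> 0 m) \<partial>M)"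
      using expectation_queue_Markov[of "\<lambda>\<eta>. odd_ind (queue \<eta> 0 m)" 0 odd_ind k m]
      by (simp add: queue_fun_upd)
    also have "\<dots> = (queue_op \<rho> ^^ m) (\<lambda>w. odd_ind w * (queue_op \<rho> ^^ k) odd_ind w) 0"
      using rho by (intro expectation_queue abs_mult_le_1 queue_op_pow_abs_le) auto
    finally show ?thesis .
  qed
  then show "(\<lambda>m. \<integral>\<eta>. ?F m \<eta> \<partial>M) \<longlonglongrightarrow> equilibrium (\<lambda>w. odd_ind w * (queue_op \<rho> ^^ k) odd_ind w)"
    using rho queue_op_pow_tendsto_equilibrium[of "\<lambda>w. odd_ind w * (queue_op \<rho> ^^ k) odd_ind w"]
    by (simp add: abs_mult_le_1 queue_op_pow_abs_le)
qed

text \<open>A hole at 0 is independent of the walk left of 0, which never leaves 0 at site -1 with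
  probability at least \<open>1 - ratio\<close>. Positivity makes the conditioning on
  \<open>V\<close> genuine.\<close>

lemma prob_V_pos: "prob V > 0"
proof -
  define A where "A = {\<eta>. \<forall>m. queue \<eta> (-1) m = 0}"
  have A: "A \<in> events"
  proof -
    have "{\<eta> \<in> space M. \<forall>m. queue \<eta> (-1) m = 0} \<in> events" by measurable
    then show ?thesis by (simp add: A_def)
  qed
  have "space M - A = {\<eta>. \<exists>m. 1 \<le> queue \<eta> (-1) m}"
    by (auto simp: A_def Suc_le_eq)
  then have "1 - prob A \<le> ratio"
    using prob_queue_ge[of 1 "-1"] prob_compl[OF A] by simp
  then have pos: "prob A > 0" using ratio_less_1 by simp
  have upd: "indicator V (\<eta>(0 := b)) = (if b then 0 else indicator A \<eta> :: real)" for \<eta> b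
    by (auto simp: V_eq A_def indicator_def queue_fun_upd)
  have "prob V = (\<integral>\<eta>. indicator V \<eta> \<partial>M)" by simp
  also have "\<dots> = (\<integral>\<eta>. \<rho> * indicator V (\<eta>(0 := True)) + (1 - \<rho>) * indicator V (\<eta>(0 := False)) \<partial>M)"
    by (intro integral_resample) (auto simp: indicator_def)
  also have "\<dots> = (1 - \<rho>) * prob A"
    unfolding upd using A by simp
  finally show ?thesis using rho pos by simp
qed

text \<open>On \<open>V\<close> the walk is at 0 at site 0 for every start, so it may be restarted
  there. As \<open>V\<close> depends only on sites up to 0, the Markov property factors out
  \<open>prob V\<close>.\<close>

lemma cond_measure_final_odd:
  "(\<integral>\<eta>. final \<eta> (int (2 * n + 1)) \<partial>cond_measure \<rho>) = \<rho>"
proof -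
  let ?k = "2 * n + 1"
  define Q where "Q = {\<eta>. odd (queue \<eta> (int ?k) ?k)}"
  have Q: "Q \<in> events"
  proof -
    have "{\<eta> \<in> space M. odd (queue \<eta> (int ?k) ?k)} \<in> events" by measurable
    then show ?thesis by (simp add: Q_def)
  qed
  \<comment> \<open>The walk is at 0 at site -1, and the hole at 0 holds it there by
    reflection.\<close>
  have V0: "queue \<eta> 0 m = 0" if "\<eta> \<in> V" for \<eta> m
    using that by (cases m) (auto simp: V_eq queue.simps(2) queue_step_def)
  have pos: "emeasure M V \<noteq> 0" "emeasure M V \<noteq> \<infinity>"
    using prob_V_pos by (auto simp: emeasure_eq_measure)
  have ae: "AE \<eta> in cond_measure \<rho>. final \<eta> (int ?k) = indicator Q \<eta>"
    unfolding cond_measure_def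
  proof (rule AE_uniform_measureI[OF sets_V])
    show "AE \<eta> in M. \<eta> \<in> V \<longrightarrow> final \<eta> (int ?k) = indicator Q \<eta>"
      using AE_final_eq_odd_queue
    proof eventually_elim
      case (elim \<eta>)
      show ?case
      proof
        assume "\<eta> \<in> V"
        then have q: "queue \<eta> (int ?k) (m + ?k) = queue \<eta> (int ?k) ?k" for m
          using queue_from_zero[of \<eta> 0 ?k m] V0 by simp
        have "\<forall>\<^sub>F m in sequentially. final \<eta> (int ?k) = odd_ind (queue \<eta> (int ?k) (m + ?k))"
          using elim by (subst eventually_sequentially_seg) simp
        then have "final \<eta> (int ?k) = odd_ind (queue \<eta> (int ?k) ?k)"
          unfolding q by simp
        then show "final \<eta> (int ?k) = indicator Q \<eta>"
          by (simp add: Q_def indicator_def)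
      qed
    qed
  qed
  have "(\<integral>\<eta>. final \<eta> (int ?k) \<partial>cond_measure \<rho>) = (\<integral>\<eta>. indicator Q \<eta> \<partial>cond_measure \<rho>)"
    using Q by (intro integral_cong_AE ae) (simp_all add: cond_measure_def)
  also have "\<dots> = measure (cond_measure \<rho>) Q"
    using Q by (simp add: cond_measure_def)
  also have "\<dots> = prob (V \<inter> Q) / prob V"
    unfolding cond_measure_def using pos Q by (rule measure_uniform_measure)
  also have "prob (V \<inter> Q) = (\<integral>\<eta>. indicator (V \<inter> Q) \<eta> \<partial>M)"
    using Q by simp
  also have "\<dots> = (\<integral>\<eta>. indicator V \<eta> * odd_ind (queue \<eta> (0 + int ?k) (0 + ?k)) \<partial>M)"
    by (intro Bochner_Integration.integral_cong) (auto simp: Q_def indicator_def)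
  also have "\<dots> = (\<integral>\<eta>. indicator V \<eta> * (queue_op \<rho> ^^ ?k) odd_ind (queue \<eta> 0 0) \<partial>M)"
    by (rule expectation_queue_Markov) (auto simp: indicator_def V_eq queue_fun_upd)
  also have "\<dots> = \<rho> * prob V"
    by (simp only: queue_op_pow_odd_at_0 queue.simps) simp
  finally show ?thesis using prob_V_pos by simp
qed

end

theorem theorem3p6:
  fixes \<rho> :: real
  assumes "0 < \<rho>" and "\<rho> < 1/2"
  shows "(\<forall>n::int. n \<ge> 1 \<longrightarrow> (\<integral>\<eta>. final \<eta> (2 * n - 1) \<partial>cond_measure \<rho>) = \<rho>) \<and>
    (\<forall>n::int. n \<ge> 1 \<longrightarrow> two_point \<rho> (2 * n - 1) + two_point \<rho> (2 * n) = 2 * \<rho>\<^sup>2)"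
proof (intro conjI allI impI)
  fix n :: int assume "n \<ge> 1"
  \<comment> \<open>With \<open>l = n - 1\<close> as a natural number, the sites become
    \<open>2 * l + 1\<close> and \<open>2 * l + 2\<close>, the indices of the lemmas on the
    walk.\<close>
  then obtain l where n: "n = int l + 1"
    by (metis add.commute zero_le_imp_eq_int diff_add_cancel diff_ge_0_iff_ge)
  have odd: "2 * n - 1 = int (2 * l + 1)" and even: "2 * n = int (2 * l + 2)"
    by (simp_all add: n)
  show "(\<integral>\<eta>. final \<eta> (2 * n - 1) \<partial>cond_measure \<rho>) = \<rho>"
    unfolding odd by (rule cond_measure_final_odd[OF assms])
  show "two_point \<rho> (2 * n - 1) + two_point \<rho> (2 * n) = 2 * \<rho>\<^sup>2"
    unfolding odd unfolding even two_point_eq_equilibrium[OF assms]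
    by (rule equilibrium_two_point_sum[OF assms])
qed

end
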